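(* Let $P$ be an algebraic polynomial of degree $n\ge 1$ with $P(1)=1$, and let $z_1,\dots,z_n$ be its roots, listed with multiplicity. Suppose that all the roots $z_1,\dots,z_n$ are real and less than or equal to zero, and at least one of them equals $-1$. For $\varphi\in\mathbb{R}$ let $$T(\varphi)=|P(e^{i\varphi})|^2+|P(-e^{i\varphi})|^2 .$$ Then $T(\varphi)\le 1$ for every $\varphi\in\mathbb{R}$.
   Context: Algebraic polynomials have complex coefficients. *)

theory Defs
  imports Complex_Main "HOL-Computational_Algebra.Polynomial"
begin

definition T :: "complex poly \<Rightarrow> real \<Rightarrow> real" where
  "T P \<phi> = (cmod (poly P (cis \<phi>)))\<^sup>2 + (cmod (poly P (- cis \<phi>)))\<^sup>2"

end

theory Submission
  imports Defs "HOL-Computational_Algebra.Fundamental_Theorem_Algebra"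
begin

text \<open>
  For \<open>w\<close> on the unit circle and a root \<open>z \<le> 0\<close>, the triangle inequality gives
  \<open>|w - z| \<le> 1 + |z| = |1 - z|\<close>: each linear factor of \<open>P\<close> is largest at \<open>w = 1\<close>.
  Bounding in this way every factor of \<open>P\<close> except one factor \<open>w + 1\<close> belonging to the root \<open>-1\<close>
  yields \<open>2 |P(w)| \<le> |w + 1| |P(1)| = |w + 1|\<close>. Apply this at \<open>w\<close> and at \<open>-w\<close>; the parallelogram
  law \<open>|w + 1|\<^sup>2 + |w - 1|\<^sup>2 = 4\<close> shows that the two squared bounds add up to exactly \<open>1\<close>.
\<close>

lemma norm_poly_eq_prod_roots:
  fixes P :: "complex poly"
  assumes "finite I" and "image_mset z (mset_set I) = proots P"
  shows "cmod (poly P w) = cmod (lead_coeff P) * (\<Prod>i\<in>I. cmod (w - z i))"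
proof -
  have "P = smult (lead_coeff P) (\<Prod>x\<in>#proots P. [:- x, 1:])"
    by (rule complex_poly_decompose_multiset [symmetric])
  also have "(\<Prod>x\<in>#proots P. [:- x, 1:]) = (\<Prod>i\<in>I. [:- z i, 1:])"
    by (simp add: assms(2) [symmetric] image_mset.compositionality comp_def prod_unfold_prod_mset)
  finally have "poly P w = lead_coeff P * (\<Prod>i\<in>I. w - z i)"
    by (metis (no_types, lifting) poly_smult poly_prod prod.cong poly_pCons poly_0 mult_zero_right
        add_0_right mult.right_neutral uminus_add_conv_diff)
  then show ?thesis
    by (simp add: norm_mult prod_norm)
qed

lemma cmod_diff_le_of_nonpos_real:
  assumes "cmod w = 1" and "x \<in> \<real>" and "Re x \<le> 0"
  shows "cmod (w - x) \<le> cmod (1 - x)"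
proof -
  from \<open>x \<in> \<real>\<close> obtain r where r: "x = of_real r"
    by (auto elim: Reals_cases)
  have "cmod (1 - x) = 1 - r"
    using assms(3) norm_of_real [of "1 - r", where 'a = complex] by (simp add: r)
  moreover have "cmod (w - x) \<le> 1 - r"
    using norm_triangle_ineq4 [of w x] assms by (simp add: r)
  ultimately show ?thesis
    by simp
qed

lemma norm_poly_le_root_minus_one:
  fixes P :: "complex poly"
  assumes fin: "finite I" and roots: "image_mset z (mset_set I) = proots P"
    and nonpos: "\<And>i. i \<in> I \<Longrightarrow> z i \<in> \<real> \<and> Re (z i) \<le> 0"
    and k: "k \<in> I" "z k = - 1"
    and w: "cmod w = 1"
  shows "2 * cmod (poly P w) \<le> cmod (w + 1) * cmod (poly P 1)"
proof -
  have split: "cmod (poly P u) =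
      cmod (lead_coeff P) * (cmod (u + 1) * (\<Prod>i\<in>I - {k}. cmod (u - z i)))" for u
    using norm_poly_eq_prod_roots [OF fin roots, of u]
      prod.remove [OF fin k(1), of "\<lambda>i. cmod (u - z i)"] k(2) by simp
  have "(\<Prod>i\<in>I - {k}. cmod (w - z i)) \<le> (\<Prod>i\<in>I - {k}. cmod (1 - z i))"
    using nonpos by (intro prod_mono) (auto intro: cmod_diff_le_of_nonpos_real [OF w])
  then have "2 * cmod (lead_coeff P) * cmod (w + 1) * (\<Prod>i\<in>I - {k}. cmod (w - z i))
      \<le> 2 * cmod (lead_coeff P) * cmod (w + 1) * (\<Prod>i\<in>I - {k}. cmod (1 - z i))"
    by (intro mult_left_mono) auto
  then show ?thesis
    unfolding split [of w] split [of 1] by (simp add: mult_ac)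
qed

lemma cmod_parallelogram_law:
  "(cmod (a + b))\<^sup>2 + (cmod (a - b))\<^sup>2 = 2 * (cmod a)\<^sup>2 + 2 * (cmod b)\<^sup>2"
  unfolding cmod_power2 by (simp add: power2_eq_square algebra_simps)

theorem corollary2:
  fixes P :: "complex poly" and n :: nat and z :: "nat \<Rightarrow> complex"
  assumes "degree P = n" and "n \<ge> 1" and "poly P 1 = 1"
    and "image_mset z (mset_set {1..n}) = proots P"
    and "\<forall>i\<in>{1..n}. z i \<in> \<real> \<and> Re (z i) \<le> 0"
    and "\<exists>i\<in>{1..n}. z i = - 1"
  shows "\<forall>\<phi>::real. T P \<phi> \<le> 1"
proof
  fix \<phi> :: real
  from assms(6) obtain k where k: "k \<in> {1..n}" "z k = - 1"
    by blast
  have bound: "4 * (cmod (poly P w))\<^sup>2 \<le> (cmod (w + 1))\<^sup>2" if "cmod w = 1" for w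
  proof -
    have "2 * cmod (poly P w) \<le> cmod (w + 1)"
      using norm_poly_le_root_minus_one [OF _ assms(4) _ k that] assms(3,5) by simp
    then have "(2 * cmod (poly P w))\<^sup>2 \<le> (cmod (w + 1))\<^sup>2"
      by (intro power_mono) auto
    then show ?thesis
      by (simp add: power_mult_distrib)
  qed
  have "(cmod (cis \<phi> + 1))\<^sup>2 + (cmod (- cis \<phi> + 1))\<^sup>2 = 4"
    using cmod_parallelogram_law [of 1 "cis \<phi>"] by (simp add: add.commute)
  then show "T P \<phi> \<le> 1"
    using bound [of "cis \<phi>"] bound [of "- cis \<phi>"] by (simp add: T_def)
qed

end
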